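(* Let $m\ge1$ be an integer, $t_1,\dots,t_m\in\mathbb{R}$ with $t_m>0$, and $\lambda>-1$. For each $k=1,2,\dots,m$ and $n\ge 1$, $$\frac{\partial\beta_n}{\partial t_k}=F_{1,n}\bigl(F_{k,n-1}-F_{k,n+1}\bigr),$$ where $\beta_n$ are the recurrence coefficients of the monic orthogonal polynomials with respect to $w(x;T_m;\lambda)=|x|^{2\lambda+1}\exp(-\sum_{k=1}^m t_kx^{2k})$, $F_{1,n}=\beta_n$, and for $k=2,\dots,m$ $$F_{k,n}=F_{1,n}(F_{k-1,n-1}+2F_{k-1,n}+F_{k-1,n+1})+F_{1,n}\sum_{\substack{i+j=k-1\\1\le i,j\le k-2}}(F_{i,n}+F_{i,n+1})(F_{j,n-1}+F_{j,n})-\sum_{\substack{i+j=k\\1\le i,j\le k-1}}F_{i,n}F_{j,n}.$$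
   Context: Let $T_m=(t_1,\dots,t_m)$. $P_n(x;T_m;\lambda)$ is the monic polynomial of degree $n$ in the sequence orthogonal with respect to $w(x;T_m;\lambda)\,dx$ on $\mathbb{R}$; since $w$ is even, $xP_n=P_{n+1}+\beta_nP_{n-1}$ with $P_0=1$, $P_{-1}=0$, $\beta_0=0$, which defines $\beta_n=\beta_n(T_m;\lambda)$. Convention: $\beta_j=0$ for $j\le0$; empty sums are zero. *)

theory Defs
  imports "HOL-Analysis.Analysis" "HOL-Computational_Algebra.Polynomial"
begin

text \<open>
  The parameter vector is a function \<open>t\<close> on indices, of which only \<open>t 1, \<dots>, t m\<close> are used.
  Since \<open>0 powr a = 0\<close>, the value at \<open>x = 0\<close> is \<open>0\<close>, also where the mathematical value is
  \<open>1\<close> (\<open>2 * lam + 1 = 0\<close>) or infinite (\<open>2 * lam + 1 < 0\<close>); a single point does not affect the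
  measure \<open>w dx\<close>.
\<close>

definition weight :: "nat \<Rightarrow> (nat \<Rightarrow> real) \<Rightarrow> real \<Rightarrow> real \<Rightarrow> real" where
  "weight m t lam x = \<bar>x\<bar> powr (2 * lam + 1) * exp (- (\<Sum>k=1..m. t k * x ^ (2 * k)))"

definition monic_orthogonal_seq :: "(real \<Rightarrow> real) \<Rightarrow> (nat \<Rightarrow> real poly) \<Rightarrow> bool" where
  "monic_orthogonal_seq w P \<longleftrightarrow>
     (\<forall>n. degree (P n) = n \<and> lead_coeff (P n) = 1) \<and>
     (\<forall>i j. integrable lborel (\<lambda>x. poly (P i) x * poly (P j) x * w x)) \<and>
     (\<forall>i j. i \<noteq> j \<longrightarrow> (\<integral>x. poly (P i) x * poly (P j) x * w x \<partial>lborel) = 0)"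

text \<open>Integer indices, so that \<open>P\<^sub>n\<close> and \<open>\<beta>\<^sub>n\<close> make sense for negative \<open>n\<close>.\<close>

definition orth_poly :: "(real \<Rightarrow> real) \<Rightarrow> int \<Rightarrow> real poly" where
  "orth_poly w n = (if n < 0 then 0 else (THE P. monic_orthogonal_seq w P) (nat n))"

definition rec_coeff :: "(real \<Rightarrow> real) \<Rightarrow> int \<Rightarrow> real" where
  "rec_coeff w n =
     (if n \<le> 0 then 0
      else (THE b. [:0, 1:] * orth_poly w n = orth_poly w (n + 1) + smult b (orth_poly w (n - 1))))"

definition rec_beta :: "nat \<Rightarrow> (nat \<Rightarrow> real) \<Rightarrow> real \<Rightarrow> int \<Rightarrow> real" where
  "rec_beta m t lam n = rec_coeff (weight m t lam) n"

text \<open>\<open>rec_F b k n\<close> is \<open>F\<^sub>k\<^sub>,\<^sub>n\<close> built from the coefficients \<open>b\<close>; the value at \<open>k = 0\<close> is a dummy.\<close>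

function rec_F :: "(int \<Rightarrow> real) \<Rightarrow> nat \<Rightarrow> int \<Rightarrow> real" where
  "rec_F b k n =
     (if k = 0 then 0
      else if k = 1 then b n
      else rec_F b 1 n * (rec_F b (k - 1) (n - 1) + 2 * rec_F b (k - 1) n + rec_F b (k - 1) (n + 1))
        + rec_F b 1 n * (\<Sum>(i, j) \<in> {(i, j). i + j = k - 1 \<and> 1 \<le> i \<and> i \<le> k - 2 \<and> 1 \<le> j \<and> j \<le> k - 2}.
              (rec_F b i n + rec_F b i (n + 1)) * (rec_F b j (n - 1) + rec_F b j n))
        - (\<Sum>(i, j) \<in> {(i, j). i + j = k \<and> 1 \<le> i \<and> i \<le> k - 1 \<and> 1 \<le> j \<and> j \<le> k - 1}.
              rec_F b i n * rec_F b j n))"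
  by pat_completeness auto
termination
  by (relation "Wellfounded.measure (\<lambda>(b, k, n). k)") auto

declare rec_F.simps [simp del]

end

theory Submission
  imports Defs "HOL-Computational_Algebra.Formal_Power_Series"
begin

text \<open>
  Let \<open>L\<close> be the matrix of multiplication by \<open>x\<close> in the basis \<open>P\<^sub>n\<close>. Since \<open>\<beta>\<^sub>n = h\<^sub>n / h\<^sub>n\<^sub>-\<^sub>1\<close> for the
  squared norms \<open>h\<^sub>n\<close>, and the derivative of \<open>h\<^sub>n\<close> in \<open>t\<^sub>k\<close> is minus the integral of \<open>x^(2k) P\<^sub>n^2 w\<close> (the
  derivative of \<open>P\<^sub>n\<close> has lower degree, hence is orthogonal to \<open>P\<^sub>n\<close>), the derivative of \<open>\<beta>\<^sub>n\<close> is \<open>\<beta>\<^sub>n\<close> times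
  the difference of the diagonal entries \<open>n - 1\<close> and \<open>n\<close> of \<open>L^(2k)\<close>. The \<open>n\<close>-th diagonal entry is
  \<open>F\<^sub>k\<^sub>,\<^sub>n + F\<^sub>k\<^sub>,\<^sub>n\<^sub>+\<^sub>1\<close>, where \<open>F\<^sub>k\<^sub>,\<^sub>n\<close> is the entry \<open>(n, n - 1)\<close> of \<open>L^(2k-1)\<close>. The recursion for
  \<open>F\<^sub>k\<^sub>,\<^sub>n\<close> is the coefficient form of a quadratic identity between the generating functions
  \<open>f\<^sub>n = \<Sum>\<^sub>k F\<^sub>k\<^sub>,\<^sub>n X^k\<close>, namely \<open>X \<beta>\<^sub>n (1 + f\<^sub>n + f\<^sub>n\<^sub>+\<^sub>1) (1 + f\<^sub>n\<^sub>-\<^sub>1 + f\<^sub>n) = f\<^sub>n + f\<^sub>n^2\<close>.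
\<close>

section \<open>Orthogonal polynomials of an even positive functional\<close>

text \<open>The Stieltjes recursion for an even functional. Being explicit, it lets
  differentiability in a parameter pass from \<open>P_n\<close> to \<open>P_(n+1)\<close> by
  induction.\<close>

fun symm_poly :: "(real poly \<Rightarrow> real) \<Rightarrow> nat \<Rightarrow> real poly" where
  "symm_poly J 0 = 1"
| "symm_poly J (Suc 0) = [:0, 1:]"
| "symm_poly J (Suc (Suc n)) = [:0, 1:] * symm_poly J (Suc n) -
     smult (J (symm_poly J (Suc n) * symm_poly J (Suc n)) / J (symm_poly J n * symm_poly J n))
       (symm_poly J n)"

definition sq_norm :: "(real poly \<Rightarrow> real) \<Rightarrow> nat \<Rightarrow> real" where
  "sq_norm J n = J (symm_poly J n * symm_poly J n)"

text \<open>The value 0 at \<open>n = 0\<close> removes the term with the truncated index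
  \<open>n - 1\<close>, so one recurrence covers every \<open>n\<close>.\<close>

definition symm_beta :: "(real poly \<Rightarrow> real) \<Rightarrow> nat \<Rightarrow> real" where
  "symm_beta J n = (if n = 0 then 0 else sq_norm J n / sq_norm J (n - 1))"

lemma symm_poly_Suc:
  "symm_poly J (Suc n) = [:0, 1:] * symm_poly J n - smult (symm_beta J n) (symm_poly J (n - 1))"
  by (cases n) (auto simp: symm_beta_def sq_norm_def)

lemma x_times_symm_poly:
  "[:0, 1:] * symm_poly J n = symm_poly J (Suc n) + smult (symm_beta J n) (symm_poly J (n - 1))"
  by (simp add: symm_poly_Suc)

declare symm_poly.simps [simp del]

lemma symm_poly_0 [simp]: "symm_poly J 0 = 1"
  by (simp add: symm_poly.simps)

lemma symm_beta_0 [simp]: "symm_beta J 0 = 0"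
  by (simp add: symm_beta_def)

lemma coeff_symm_poly_ge: "n \<le> i \<Longrightarrow> coeff (symm_poly J n) i = (if i = n then 1 else 0)"
proof (induction n arbitrary: i rule: less_induct)
  case (less n)
  show ?case
  proof (cases n)
    case 0
    then show ?thesis by (auto simp: coeff_eq_0)
  next
    case (Suc l)
    obtain i' where i: "i = Suc i'" using less.prems Suc by (cases i) auto
    have "coeff (symm_poly J l) i' = (if i' = l then 1 else 0)"
      using less Suc i by auto
    moreover have "symm_beta J l * coeff (symm_poly J (l - 1)) i = 0"
      using less Suc i by (cases "l = 0") auto
    ultimately show ?thesis
      using Suc i by (auto simp: symm_poly_Suc coeff_pCons)
  qed
qed

lemma degree_symm_poly [simp]: "degree (symm_poly J n) = n"
  by (intro antisym degree_le le_degree) (auto simp: coeff_symm_poly_ge)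

lemma lead_coeff_symm_poly [simp]: "coeff (symm_poly J n) n = 1"
  by (simp add: coeff_symm_poly_ge)

lemma symm_poly_nonzero [simp]: "symm_poly J n \<noteq> 0"
  using lead_coeff_symm_poly[of J n] by (metis coeff_0 zero_neq_one)

lemma symm_poly_reflect: "symm_poly J n \<circ>\<^sub>p [:0, -1:] = smult ((-1) ^ n) (symm_poly J n)"
proof (induction n rule: less_induct)
  case (less n)
  show ?case
  proof (cases n)
    case (Suc l)
    show ?thesis
    proof (cases l)
      case (Suc l')
      then show ?thesis using less[of l] less[of l'] \<open>n = Suc l\<close>
        by (simp add: symm_poly_Suc pcompose_diff pcompose_smult pcompose_pCons algebra_simps smult_diff_right)
    qed (use Suc in \<open>simp add: symm_poly_Suc pcompose_pCons\<close>)
  qed (simp add: pcompose_1)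
qed

text \<open>With vanishing constant terms the two end terms of the Cauchy product drop out, so the
  sums over pairs in \<open>rec_F\<close> become coefficients of products of power series.\<close>

lemma sum_pairs_eq_fps_nth:
  fixes u v :: "'a :: comm_ring_1 fps"
  assumes "fps_nth u 0 = 0" "fps_nth v 0 = 0"
  shows "fps_nth (u * v) k =
    (\<Sum>(i, j) \<in> {(i, j). i + j = k \<and> 1 \<le> i \<and> i \<le> k - 1 \<and> 1 \<le> j \<and> j \<le> k - 1}. fps_nth u i * fps_nth v j)"
proof -
  have "fps_nth (u * v) k = (\<Sum>i=0..k. fps_nth u i * fps_nth v (k - i))"
    by (simp add: fps_mult_nth)
  also have "\<dots> = (\<Sum>i\<in>{1..<k}. fps_nth u i * fps_nth v (k - i))"
  proof (rule sum.mono_neutral_right)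
    show "\<forall>i\<in>{0..k} - {1..<k}. fps_nth u i * fps_nth v (k - i) = 0"
    proof
      fix i assume "i \<in> {0..k} - {1..<k}"
      then have "i = 0 \<or> i = k" by auto
      then show "fps_nth u i * fps_nth v (k - i) = 0" using assms by auto
    qed
  qed auto
  also have "\<dots> = (\<Sum>(i, j) \<in> {(i, j). i + j = k \<and> 1 \<le> i \<and> i \<le> k - 1 \<and> 1 \<le> j \<and> j \<le> k - 1}. fps_nth u i * fps_nth v j)"
    by (rule sum.reindex_bij_witness[where j = "\<lambda>i. (i, k - i)" and i = fst]) auto
  finally show ?thesis .
qed

locale even_positive_functional =
  fixes J :: "real poly \<Rightarrow> real"
  assumes add: "J (p + q) = J p + J q"
    and smult: "J (smult c p) = c * J p"
    and pos: "p \<noteq> 0 \<Longrightarrow> J (p * p) > 0"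
    and even: "J (p \<circ>\<^sub>p [:0, -1:]) = J p"
begin

lemma zero [simp]: "J 0 = 0"
  using smult[of 0 0] by simp

lemma uminus: "J (- p) = - J p"
  using smult[of "-1" p] by simp

lemma diff: "J (p - q) = J p - J q"
  using add[of p "- q"] by (simp add: uminus)

lemma sum: "J (\<Sum>i\<in>A. f i) = (\<Sum>i\<in>A. J (f i))"
  by (induction A rule: infinite_finite_induct) (auto simp: add)

lemma sq_norm_pos: "sq_norm J n > 0"
  unfolding sq_norm_def by (intro pos) simp

lemma sq_norm_nonzero [simp]: "sq_norm J n \<noteq> 0"
  using sq_norm_pos[of n] by simp

lemma sq_norm_Suc: "sq_norm J (Suc n) = symm_beta J (Suc n) * sq_norm J n"
  by (simp add: symm_beta_def)

lemma odd_product: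
  assumes "odd (i + j)"
  shows "J (symm_poly J i * symm_poly J j) = 0"
proof -
  have "J (symm_poly J i * symm_poly J j) = J ((symm_poly J i * symm_poly J j) \<circ>\<^sub>p [:0, -1:])"
    by (simp add: even)
  also have "\<dots> = J (smult ((-1) ^ (i + j)) (symm_poly J i * symm_poly J j))"
    by (simp add: pcompose_mult symm_poly_reflect power_add mult.commute)
  also have "\<dots> = - J (symm_poly J i * symm_poly J j)"
    using assms by (simp add: uminus)
  finally show ?thesis by simp
qed

text \<open>Multiplication by x is symmetric for \<open>J\<close>: the recurrence first lowers
  \<open>Suc j\<close> and then absorbs the factor x into \<open>symm_poly J i\<close>.\<close>

lemma move_x:
  "J (symm_poly J i * symm_poly J (Suc j)) =
     J (symm_poly J (Suc i) * symm_poly J j) + symm_beta J i * J (symm_poly J (i - 1) * symm_poly J j)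
     - symm_beta J j * J (symm_poly J i * symm_poly J (j - 1))"
proof -
  have "symm_poly J i * symm_poly J (Suc j) =
    ([:0, 1:] * symm_poly J i) * symm_poly J j - smult (symm_beta J j) (symm_poly J i * symm_poly J (j - 1))"
    by (simp add: symm_poly_Suc[of J j] algebra_simps)
  then show ?thesis
    unfolding x_times_symm_poly by (simp add: diff add smult distrib_right)
qed

text \<open>Parity settles adjacent indices. At distance two the ratio of norms in
  \<open>symm_beta\<close> makes the two surviving terms cancel; beyond that the induction
  hypothesis kills every term of \<open>move_x\<close>.\<close>

lemma symm_poly_orthogonal_less: "j < n \<Longrightarrow> J (symm_poly J j * symm_poly J n) = 0"
proof (induction n arbitrary: j rule: less_induct)
  case (less n)
  then obtain l where l: "n = Suc l" by (cases n) auto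
  consider "j = l" | "Suc j = l" | "Suc j < l" using less.prems l by linarith
  then show ?case
  proof cases
    case 1
    then show ?thesis using l by (intro odd_product) simp
  next
    case 2
    have "symm_beta J j * J (symm_poly J (j - 1) * symm_poly J l) = 0"
      using less.IH[of l "j - 1"] 2 l by (cases "j = 0") auto
    moreover have "symm_beta J l * J (symm_poly J j * symm_poly J (l - 1)) = J (symm_poly J l * symm_poly J l)"
      using sq_norm_Suc[of j] 2 by (auto simp: sq_norm_def)
    ultimately show ?thesis using 2 unfolding l move_x by simp
  next
    case 3
    then show ?thesis using less.IH[of l] less.IH[of "l - 1"] l
      unfolding l move_x by simp
  qed
qed

lemma symm_poly_orthogonal: "i \<noteq> j \<Longrightarrow> J (symm_poly J i * symm_poly J j) = 0"
  using symm_poly_orthogonal_less[of i j] symm_poly_orthogonal_less[of j i]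
  by (cases i j rule: linorder_cases) (auto simp: mult.commute)

text \<open>Multiples of \<open>Q d\<close> strip the top coefficients of \<open>p\<close> one by
  one. The sequence is arbitrary because uniqueness applies this to \<open>symm_poly J\<close> and
  to its rival.\<close>

lemma orthogonal_lower_degree:
  assumes "\<And>n. degree (Q n) = n" "\<And>n. coeff (Q n) n = 1"
    and "\<And>i j. i \<noteq> j \<Longrightarrow> J (Q i * Q j) = 0"
    and "\<And>i. n \<le> i \<Longrightarrow> coeff p i = 0"
  shows "J (Q n * p) = 0"
proof -
  have "J (Q n * p) = 0" if "d \<le> n" "\<And>i. d \<le> i \<Longrightarrow> coeff p i = 0" for d p
    using that
  proof (induction d arbitrary: p)
    case 0
    then have "p = 0" by (intro poly_eqI) simp
    then show ?case by simp
  next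
    case (Suc d)
    define r where "r = p - Polynomial.smult (coeff p d) (Q d)"
    have "coeff r i = 0" if "d \<le> i" for i
      using that Suc.prems assms(1)[of d] assms(2)[of d]
      by (cases "i = d") (auto simp: r_def coeff_eq_0)
    then have "J (Q n * r) = 0" using Suc by simp
    moreover have "p = r + Polynomial.smult (coeff p d) (Q d)" by (simp add: r_def)
    then have "J (Q n * p) = J (Q n * r) + coeff p d * J (Q n * Q d)"
      by (metis add distrib_left mult_smult_right smult)
    ultimately show ?case using assms(3)[of n d] Suc.prems(1) by simp
  qed
  then show ?thesis using assms(4) by blast
qed

text \<open>The difference of the two candidates has only lower terms, so it is orthogonal to both
  of them and hence to itself.\<close>

lemma monic_orthogonal_unique:
  assumes "\<And>n. degree (Q n) = n" "\<And>n. coeff (Q n) n = 1"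
    and "\<And>i j. i \<noteq> j \<Longrightarrow> J (Q i * Q j) = 0"
  shows "Q n = symm_poly J n"
proof (rule ccontr)
  define d where "d = Q n - symm_poly J n"
  assume "Q n \<noteq> symm_poly J n"
  then have "J (d * d) > 0" by (intro pos) (simp add: d_def)
  have low: "coeff d i = 0" if "n \<le> i" for i
    using that assms(1)[of n] assms(2)[of n]
    by (cases "i = n") (auto simp: d_def coeff_eq_0)
  have "J (d * d) = J (Q n * d) - J (symm_poly J n * d)"
    by (simp add: d_def left_diff_distrib diff)
  also have "\<dots> = 0"
    using orthogonal_lower_degree[of Q n d] orthogonal_lower_degree[of "symm_poly J" n d] assms low
    by (simp add: symm_poly_orthogonal)
  finally show False using \<open>J (d * d) > 0\<close> by simp
qed

section \<open>Entries of the powers of the multiplication matrix\<close>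

text \<open>\<open>diag k n\<close> and \<open>subdiag k n\<close> are the entries \<open>(n, n)\<close> of \<open>L^(2k)\<close> and \<open>(n, n - 1)\<close> of \<open>L^(2k-1)\<close>.\<close>

definition diag :: "nat \<Rightarrow> nat \<Rightarrow> real" where
  "diag k n = J (monom 1 (2 * k) * (symm_poly J n * symm_poly J n)) / sq_norm J n"

definition subdiag :: "nat \<Rightarrow> nat \<Rightarrow> real" where
  "subdiag k n = (if k = 0 \<or> n = 0 then 0
     else J (monom 1 (2 * k - 1) * (symm_poly J n * symm_poly J (n - 1))) / sq_norm J (n - 1))"

lemma subdiag_0 [simp]: "subdiag 0 n = 0" "subdiag k 0 = 0"
  by (simp_all add: subdiag_def)

lemma diag_0 [simp]: "diag 0 n = 1"
  using sq_norm_nonzero[of n] by (simp add: diag_def sq_norm_def flip: one_pCons)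

lemma peel_x:
  "J (monom 1 (Suc l) * (symm_poly J i * q)) =
     J (monom 1 l * (symm_poly J (Suc i) * q)) + symm_beta J i * J (monom 1 l * (symm_poly J (i - 1) * q))"
proof -
  have "monom 1 (Suc l) * (symm_poly J i * q) = monom 1 l * (([:0, 1:] * symm_poly J i) * q)"
    by (simp add: monom_Suc)
  then show ?thesis
    unfolding x_times_symm_poly by (simp add: add smult algebra_simps)
qed

text \<open>One factor x leads from n to n + 1 or n - 1, and beta_n / h_n = 1 / h_(n-1) for n >= 1.
  At \<open>k = 0\<close> the left side would be 1 and the right side 0.\<close>

lemma diag_eq_subdiag:
  assumes "k > 0"
  shows "diag k n = subdiag k n + subdiag k (Suc n)"
proof -
  obtain l where l: "k = Suc l" using assms by (cases k) auto
  have "diag k n = J (monom 1 (2 * l + 1) * (symm_poly J (Suc n) * symm_poly J n)) / sq_norm J n +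
    symm_beta J n * J (monom 1 (2 * l + 1) * (symm_poly J (n - 1) * symm_poly J n)) / sq_norm J n"
    using peel_x[of "2 * l + 1" n "symm_poly J n"]
    by (simp add: diag_def l add_divide_distrib)
  moreover have "symm_beta J n * c / sq_norm J n = (if n = 0 then 0 else c / sq_norm J (n - 1))" for c
    by (simp add: symm_beta_def)
  ultimately show ?thesis
    by (auto simp: subdiag_def l mult.commute)
qed

text \<open>In both entries one factor x is expanded on \<open>P_n\<close>. The terms pairing
  \<open>P_(n-1)\<close> with \<open>P_(n+1)\<close> cancel since beta_n / h_n = 1 / h_(n-1);
  diagonal entries remain.\<close>

lemma subdiag_step:
  "subdiag (Suc k) (Suc n) - subdiag (Suc k) n =
     symm_beta J (Suc n) * diag k (Suc n) - symm_beta J n * diag k (n - 1)"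
proof -
  let ?M = "\<lambda>i j. J (monom 1 (2 * k) * (symm_poly J i * symm_poly J j))"
  have 1: "subdiag (Suc k) (Suc n) = (?M (Suc n) (Suc n) + symm_beta J n * ?M (n - 1) (Suc n)) / sq_norm J n"
    using peel_x[of "2 * k" n "symm_poly J (Suc n)"]
    by (simp add: subdiag_def mult.commute)
  have 2: "?M (Suc n) (Suc n) / sq_norm J n = symm_beta J (Suc n) * diag k (Suc n)"
    by (simp add: diag_def symm_beta_def)
  show ?thesis
  proof (cases n)
    case 0
    then show ?thesis using 1 2 by simp
  next
    case (Suc l)
    have "subdiag (Suc k) n = (?M (Suc n) l + symm_beta J n * ?M l l) / sq_norm J l"
      using peel_x[of "2 * k" n "symm_poly J l"] Suc
      by (simp add: subdiag_def mult.commute)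
    then have "subdiag (Suc k) n = ?M l (Suc n) / sq_norm J l + symm_beta J n * diag k l"
      by (simp add: diag_def add_divide_distrib mult.commute)
    moreover have "symm_beta J n * ?M l (Suc n) / sq_norm J n = ?M l (Suc n) / sq_norm J l"
      by (simp add: symm_beta_def Suc)
    ultimately show ?thesis using 1 2 Suc by (simp add: add_divide_distrib)
  qed
qed

section \<open>Generating functions in \<open>k\<close> and their quadratic identity\<close>

definition subdiag_fps :: "nat \<Rightarrow> real fps" where
  "subdiag_fps n = Abs_fps (\<lambda>k. subdiag k n)"

lemma subdiag_fps_0 [simp]: "subdiag_fps 0 = 0"
  by (simp add: subdiag_fps_def fps_eq_iff)

lemma diag_fps: "Abs_fps (\<lambda>k. diag k n) = 1 + subdiag_fps n + subdiag_fps (Suc n)"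
  by (auto simp: fps_eq_iff subdiag_fps_def diag_eq_subdiag)

lemma subdiag_fps_step:
  "subdiag_fps (Suc n) - subdiag_fps n =
    fps_X * (fps_const (symm_beta J (Suc n)) * (1 + subdiag_fps (Suc n) + subdiag_fps (Suc (Suc n)))
      - fps_const (symm_beta J n) * (1 + subdiag_fps (n - 1) + subdiag_fps (Suc (n - 1))))"
proof (rule fps_ext)
  fix k
  show "fps_nth (subdiag_fps (Suc n) - subdiag_fps n) k = fps_nth (fps_X * (fps_const (symm_beta J (Suc n)) * (1 + subdiag_fps (Suc n) + subdiag_fps (Suc (Suc n)))
      - fps_const (symm_beta J n) * (1 + subdiag_fps (n - 1) + subdiag_fps (Suc (n - 1))))) k"
    unfolding diag_fps[symmetric]
    by (cases k) (simp_all add: subdiag_fps_def subdiag_step)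
qed

text \<open>
  The difference of the identities at \<open>n + 1\<close> and \<open>n\<close> is \<open>subdiag_fps_step\<close> multiplied by
  \<open>1 + f\<^sub>n + f\<^sub>n\<^sub>+\<^sub>1\<close>.
\<close>
lemma subdiag_fps_quadratic:
  "fps_X * fps_const (symm_beta J n) * (1 + subdiag_fps n + subdiag_fps (Suc n)) *
     (1 + subdiag_fps (n - 1) + subdiag_fps n) = subdiag_fps n + subdiag_fps n * subdiag_fps n"
proof (induction n)
  case (Suc n)
  \<comment> \<open>\<open>Suc (n - 1)\<close> differs from \<open>n\<close> only at
    \<open>n = 0\<close>, where the coefficient is 0.\<close>
  have "fps_const (symm_beta J n) * (1 + subdiag_fps (n - 1) + subdiag_fps (Suc (n - 1))) =
    fps_const (symm_beta J n) * (1 + subdiag_fps (n - 1) + subdiag_fps n)"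
    by (cases n) auto
  with Suc subdiag_fps_step[of n] show ?case
    unfolding diff_Suc_1 by algebra
qed simp

lemma subdiag_1: "subdiag 1 n = symm_beta J n"
proof (induction n)
  case (Suc n)
  then show ?case using subdiag_step[of 0 n] by simp
qed simp

text \<open>The coefficient of \<open>X^k\<close>, with the two factors written \<open>1 + U\<close>
  and \<open>1 + V\<close>: \<open>U + V\<close> gives the linear bracket, \<open>U * V\<close> the
  double sum, the square of \<open>f_n\<close> the subtracted sum. Since \<open>k >= 2\<close>, the
  constant 1 contributes nothing.\<close>

lemma subdiag_recurrence:
  assumes "k \<ge> 2" "n \<ge> 1"
  shows "subdiag k n = symm_beta J n * (subdiag (k - 1) (n - 1) + 2 * subdiag (k - 1) n + subdiag (k - 1) (n + 1))
    + symm_beta J n * (\<Sum>(i, j) \<in> {(i, j). i + j = k - 1 \<and> 1 \<le> i \<and> i \<le> k - 2 \<and> 1 \<le> j \<and> j \<le> k - 2}.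
        (subdiag i n + subdiag i (n + 1)) * (subdiag j (n - 1) + subdiag j n))
    - (\<Sum>(i, j) \<in> {(i, j). i + j = k \<and> 1 \<le> i \<and> i \<le> k - 1 \<and> 1 \<le> j \<and> j \<le> k - 1}.
        subdiag i n * subdiag j n)"
proof -
  let ?U = "subdiag_fps n + subdiag_fps (Suc n)"
  let ?V = "subdiag_fps (n - 1) + subdiag_fps n"
  obtain l where l: "k = Suc l" "l \<ge> 1" using assms by (cases k) auto
  have "fps_X * (fps_const (symm_beta J n) * (1 + ?U + ?V + ?U * ?V)) =
      subdiag_fps n + subdiag_fps n * subdiag_fps n"
    unfolding subdiag_fps_quadratic[of n, symmetric] by (simp add: algebra_simps)
  from arg_cong[OF this, of "\<lambda>f. fps_nth f k"]
  have "symm_beta J n * (fps_nth (?U + ?V) l + fps_nth (?U * ?V) l) =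
      subdiag k n + fps_nth (subdiag_fps n * subdiag_fps n) k"
    using l by (simp add: subdiag_fps_def add.assoc)
  then have "subdiag k n = symm_beta J n * fps_nth (?U + ?V) l + symm_beta J n * fps_nth (?U * ?V) l
      - fps_nth (subdiag_fps n * subdiag_fps n) k"
    by (simp only: distrib_left)
  moreover have "fps_nth (?U * ?V) l = (\<Sum>(i, j) \<in> {(i, j). i + j = l \<and> 1 \<le> i \<and> i \<le> l - 1 \<and> 1 \<le> j \<and> j \<le> l - 1}.
        (subdiag i n + subdiag i (n + 1)) * (subdiag j (n - 1) + subdiag j n))"
    using sum_pairs_eq_fps_nth[of ?U ?V l] by (simp add: subdiag_fps_def)
  moreover have "fps_nth (subdiag_fps n * subdiag_fps n) k =
     (\<Sum>(i, j) \<in> {(i, j). i + j = k \<and> 1 \<le> i \<and> i \<le> k - 1 \<and> 1 \<le> j \<and> j \<le> k - 1}.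
        subdiag i n * subdiag j n)"
    using sum_pairs_eq_fps_nth[of "subdiag_fps n" "subdiag_fps n" k] by (simp add: subdiag_fps_def)
  moreover have "fps_nth (?U + ?V) l = subdiag l (n - 1) + 2 * subdiag l n + subdiag l (n + 1)"
    by (simp add: subdiag_fps_def)
  moreover have "k - 1 = l" "k - 2 = l - 1" using l by auto
  ultimately show ?thesis by (simp only:)
qed

section \<open>Identification of \<open>rec_F\<close> with the matrix entries\<close>

lemma rec_F_eq_subdiag:
  assumes b: "\<And>n. b (int n) = symm_beta J n" and "k \<ge> 1"
  shows "rec_F b k (int n) = subdiag k n"
  using \<open>k \<ge> 1\<close>
proof (induction k arbitrary: n rule: less_induct)
  case (less k)
  have b1: "rec_F b 1 (int n) = symm_beta J n"
    by (subst rec_F.simps) (simp add: b)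
  show ?case
  proof (cases "k = 1")
    case True
    then show ?thesis using b1 subdiag_1 by simp
  next
    case False
    with less.prems have k: "k \<ge> 2" by simp
    show ?thesis
    proof (cases n)
      \<comment> \<open>Here the recursion reaches index -1, where \<open>b\<close> is unspecified;
        the factor \<open>b 0 = 0\<close> removes those terms.\<close>
      case 0
      have "(\<Sum>(i, j) \<in> {(i, j). i + j = k \<and> 1 \<le> i \<and> i \<le> k - 1 \<and> 1 \<le> j \<and> j \<le> k - 1}.
              rec_F b i 0 * rec_F b j 0) = 0"
        using less.IH[of _ 0] by (intro sum.neutral) force
      then show ?thesis using b1 0 k by (subst rec_F.simps) simp
    next
      case (Suc l)
      have n: "int n - 1 = int (n - 1)" "int n + 1 = int (n + 1)" using Suc by auto
      have "(\<Sum>(i, j) \<in> {(i, j). i + j = k - 1 \<and> 1 \<le> i \<and> i \<le> k - 2 \<and> 1 \<le> j \<and> j \<le> k - 2}.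
              (rec_F b i (int n) + rec_F b i (int (n + 1))) * (rec_F b j (int (n - 1)) + rec_F b j (int n))) =
            (\<Sum>(i, j) \<in> {(i, j). i + j = k - 1 \<and> 1 \<le> i \<and> i \<le> k - 2 \<and> 1 \<le> j \<and> j \<le> k - 2}.
              (subdiag i n + subdiag i (n + 1)) * (subdiag j (n - 1) + subdiag j n))"
        by (intro sum.cong refl) (auto simp: less.IH simp del: of_nat_add of_nat_Suc)
      moreover have "(\<Sum>(i, j) \<in> {(i, j). i + j = k \<and> 1 \<le> i \<and> i \<le> k - 1 \<and> 1 \<le> j \<and> j \<le> k - 1}.
              rec_F b i (int n) * rec_F b j (int n)) =
            (\<Sum>(i, j) \<in> {(i, j). i + j = k \<and> 1 \<le> i \<and> i \<le> k - 1 \<and> 1 \<le> j \<and> j \<le> k - 1}.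
              subdiag i n * subdiag j n)"
        by (intro sum.cong refl) (auto simp: less.IH)
      moreover have "rec_F b (k - 1) (int n') = subdiag (k - 1) n'" for n'
        using k by (intro less.IH) auto
      moreover have "k \<noteq> 0" "n \<ge> 1" using k Suc by auto
      ultimately show ?thesis
        using False
        by (subst rec_F.simps) (simp only: n b1 if_False subdiag_recurrence[OF k])
    qed
  qed
qed

end

section \<open>Dependence on a parameter\<close>

text \<open>Coefficientwise, so that no topology on polynomials enters; wherever a functional is
  differentiated, the degree is bounded.\<close>

definition has_poly_derivative :: "(real \<Rightarrow> real poly) \<Rightarrow> real poly \<Rightarrow> real \<Rightarrow> bool" where
  "has_poly_derivative p q s0 \<longleftrightarrow>
     (\<forall>i. ((\<lambda>s. coeff (p s) i) has_real_derivative coeff q i) (at s0))"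

lemma has_poly_derivative_const: "has_poly_derivative (\<lambda>_. p) 0 s0"
  by (simp add: has_poly_derivative_def)

lemma has_poly_derivative_diff:
  assumes "has_poly_derivative p p' s0" "has_poly_derivative q q' s0"
  shows "has_poly_derivative (\<lambda>s. p s - q s) (p' - q') s0"
  using assms by (auto simp: has_poly_derivative_def intro!: DERIV_diff)

lemma has_poly_derivative_smult:
  assumes "(c has_real_derivative c') (at s0)" "has_poly_derivative p p' s0"
  shows "has_poly_derivative (\<lambda>s. smult (c s) (p s)) (smult (c s0) p' + smult c' (p s0)) s0"
  using assms by (auto simp: has_poly_derivative_def mult.commute intro!: derivative_eq_intros)

lemma has_poly_derivative_mult:
  assumes "has_poly_derivative p p' s0" "has_poly_derivative q q' s0"
  shows "has_poly_derivative (\<lambda>s. p s * q s) (p' * q s0 + p s0 * q') s0"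
  using assms
  by (auto simp: has_poly_derivative_def coeff_mult sum.distrib[symmetric] intro!: derivative_eq_intros sum.cong)

text \<open>
  The functionals are only required to be linear on \<open>S\<close>: for \<open>t\<^sub>m \<le> 0\<close> the weight need not be
  integrable, and the Lebesgue integral takes junk values.
\<close>
locale even_positive_family =
  fixes J :: "real \<Rightarrow> real poly \<Rightarrow> real" and S :: "real set" and s0 :: real and k :: nat
  assumes open_S: "open S" and s0: "s0 \<in> S"
    and functional: "s \<in> S \<Longrightarrow> even_positive_functional (J s)"
    and deriv_J: "((\<lambda>s. J s p) has_real_derivative - J s0 (monom 1 (2 * k) * p)) (at s0)"
begin

sublocale even_positive_functional "J s0"
  using functional s0 .

text \<open>A bounded degree turns \<open>J s (p s)\<close> into a finite sum of coefficients times
  moments, to which the product rule applies termwise.\<close>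

lemma deriv_J_poly:
  assumes p: "has_poly_derivative p q s0" and deg: "\<And>s. degree (p s) \<le> N"
  shows "((\<lambda>s. J s (p s)) has_real_derivative - J s0 (monom 1 (2 * k) * p s0) + J s0 q) (at s0)"
proof -
  have q: "degree q \<le> N"
  proof (rule degree_le, intro allI impI)
    fix i assume "N < i"
    then have zero: "coeff (p s) i = 0" for s using deg[of s] by (intro coeff_eq_0) simp
    have "((\<lambda>s. 0) has_real_derivative coeff q i) (at s0)"
      using p[unfolded has_poly_derivative_def, rule_format, of i] by (simp only: zero)
    then show "coeff q i = 0" by (rule DERIV_unique[OF _ DERIV_const])
  qed
  have expand: "r = (\<Sum>i\<le>N. Polynomial.smult (coeff r i) (monom 1 i))" if "degree r \<le> N" for r :: "real poly"
    using poly_as_sum_of_monoms'[OF that] by (simp add: smult_monom)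
  have J_expand: "J s r = (\<Sum>i\<le>N. coeff r i * J s (monom 1 i))" if "degree r \<le> N" "s \<in> S" for r s
  proof -
    interpret Js: even_positive_functional "J s" using functional that by blast
    show ?thesis by (subst expand[OF that(1)]) (simp add: Js.sum Js.smult)
  qed
  have shifted: "J s0 (monom 1 (2 * k) * p s0) = (\<Sum>i\<le>N. coeff (p s0) i * J s0 (monom 1 (2 * k) * monom 1 i))"
    by (subst expand[OF deg]) (simp add: sum_distrib_left sum smult)
  have "((\<lambda>s. \<Sum>i\<le>N. coeff (p s) i * J s (monom 1 i)) has_real_derivative
      (\<Sum>i\<le>N. coeff q i * J s0 (monom 1 i) + - J s0 (monom 1 (2 * k) * monom 1 i) * coeff (p s0) i)) (at s0)"
    using p unfolding has_poly_derivative_def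
    by (intro DERIV_sum DERIV_mult deriv_J) blast
  also have "(\<Sum>i\<le>N. coeff q i * J s0 (monom 1 i) + - J s0 (monom 1 (2 * k) * monom 1 i) * coeff (p s0) i)
      = - J s0 (monom 1 (2 * k) * p s0) + J s0 q"
    unfolding shifted J_expand[OF q s0] by (simp add: sum_subtractf mult.commute)
  \<comment> \<open>The expansion in moments needs linearity of \<open>J s\<close>, assumed on
    \<open>S\<close> only; \<open>S\<close> is an open neighbourhood of \<open>s0\<close>.\<close>
  finally show ?thesis
    by (rule has_field_derivative_transform_within_open[OF _ open_S s0]) (simp add: J_expand[OF deg])
qed

text \<open>The leading coefficient of \<open>P_n\<close> is constantly 1, so \<open>q\<close> has
  only lower terms and is orthogonal to \<open>P_n\<close>; what remains is the derivative of the
  functional.\<close>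

lemma deriv_sq_norm:
  assumes "has_poly_derivative (\<lambda>s. symm_poly (J s) n) q s0"
  shows "((\<lambda>s. sq_norm (J s) n) has_real_derivative - (diag k n * sq_norm (J s0) n)) (at s0)"
proof -
  have "coeff q i = 0" if "n \<le> i" for i
  proof -
    have "((\<lambda>s. if i = n then 1 else 0) has_real_derivative coeff q i) (at s0)"
      using assms[unfolded has_poly_derivative_def, rule_format, of i] by (simp only: coeff_symm_poly_ge[OF that])
    then show ?thesis by (rule DERIV_unique[OF _ DERIV_const])
  qed
  then have "J s0 (symm_poly (J s0) n * q) = 0"
    using orthogonal_lower_degree[of "symm_poly (J s0)" n q] symm_poly_orthogonal by simp
  then have "J s0 (q * symm_poly (J s0) n + symm_poly (J s0) n * q) = 0"
    by (subst add) (simp add: mult.commute)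
  moreover have "((\<lambda>s. sq_norm (J s) n) has_real_derivative
      - J s0 (monom 1 (2 * k) * (symm_poly (J s0) n * symm_poly (J s0) n))
      + J s0 (q * symm_poly (J s0) n + symm_poly (J s0) n * q)) (at s0)"
    unfolding sq_norm_def
    by (rule deriv_J_poly[OF has_poly_derivative_mult[OF assms assms], where N = "2 * n"])
       (simp add: degree_mult_eq)
  ultimately show ?thesis by (simp add: diag_def)
qed

text \<open>The logarithmic derivative of h_n / h_(n-1). Differentiability of the polynomials is
  assumed here because its inductive proof uses this lemma.\<close>

lemma deriv_symm_beta:
  assumes "has_poly_derivative (\<lambda>s. symm_poly (J s) n) q s0"
    and "has_poly_derivative (\<lambda>s. symm_poly (J s) (n - 1)) q' s0"
  shows "((\<lambda>s. symm_beta (J s) n) has_real_derivative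
    symm_beta (J s0) n * (diag k (n - 1) - diag k n)) (at s0)"
proof (cases "n = 0")
  case False
  have "((\<lambda>s. sq_norm (J s) n / sq_norm (J s) (n - 1)) has_real_derivative
    (- (diag k n * sq_norm (J s0) n) * sq_norm (J s0) (n - 1)
       - sq_norm (J s0) n * - (diag k (n - 1) * sq_norm (J s0) (n - 1)))
      / (sq_norm (J s0) (n - 1) * sq_norm (J s0) (n - 1))) (at s0)"
    by (intro DERIV_divide deriv_sq_norm[OF assms(1)] deriv_sq_norm[OF assms(2)]) simp
  also have "(- (diag k n * sq_norm (J s0) n) * sq_norm (J s0) (n - 1)
       - sq_norm (J s0) n * - (diag k (n - 1) * sq_norm (J s0) (n - 1)))
      / (sq_norm (J s0) (n - 1) * sq_norm (J s0) (n - 1)) = symm_beta (J s0) n * (diag k (n - 1) - diag k n)"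
    using False by (simp add: symm_beta_def field_simps)
  finally show ?thesis using False by (simp add: symm_beta_def)
qed simp

text \<open>The recurrence builds \<open>P_(l+1)\<close> from \<open>P_l\<close>,
  \<open>P_(l-1)\<close> and beta_l, and the derivative of beta_l requires only those two
  polynomials.\<close>

lemma symm_poly_differentiable: "\<exists>q. has_poly_derivative (\<lambda>s. symm_poly (J s) n) q s0"
proof (induction n rule: less_induct)
  case (less n)
  show ?case
  proof (cases n)
    case 0
    then show ?thesis using has_poly_derivative_const by auto
  next
    case (Suc l)
    obtain q q' where q: "has_poly_derivative (\<lambda>s. symm_poly (J s) l) q s0"
      "has_poly_derivative (\<lambda>s. symm_poly (J s) (l - 1)) q' s0"
      using less.IH[of l] less.IH[of "l - 1"] unfolding Suc by (meson lessI less_imp_diff_less)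
    show ?thesis
      unfolding Suc symm_poly_Suc
      by (rule exI, rule has_poly_derivative_diff[OF has_poly_derivative_mult[OF has_poly_derivative_const q(1)]
            has_poly_derivative_smult[OF deriv_symm_beta[OF q] q(2)]])
  qed
qed

lemma deriv_symm_beta_subdiag:
  assumes "k \<ge> 1" "n \<ge> 1"
  shows "((\<lambda>s. symm_beta (J s) n) has_real_derivative
    symm_beta (J s0) n * (subdiag k (n - 1) - subdiag k (n + 1))) (at s0)"
proof -
  \<comment> \<open>Adjacent diagonal entries share \<open>subdiag k n\<close>, which
    cancels.\<close>
  have "diag k (n - 1) - diag k n = subdiag k (n - 1) - subdiag k (n + 1)"
    using assms by (simp add: diag_eq_subdiag)
  then show ?thesis
    using deriv_symm_beta symm_poly_differentiable by metis
qed

end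

section \<open>The weight\<close>

text \<open>The Gamma integrand at \<open>a + 1\<close> on the positive half-line is added to its
  mirror image; at x = 0 both sides vanish because \<open>0 powr a = 0\<close>.\<close>

lemma integrable_abs_powr_exp:
  fixes a :: real
  assumes "a > -1"
  shows "integrable lborel (\<lambda>x. \<bar>x\<bar> powr a * exp (- \<bar>x\<bar>))"
proof -
  let ?f = "\<lambda>x::real. indicator {0<..} x * (x powr a * exp (- x))"
  have "(\<lambda>x. complex_of_real x powr (complex_of_real (a + 1) - 1) / of_real (exp x))
      absolutely_integrable_on {0<..}"
    using assms by (intro absolutely_integrable_Gamma_integral') simp
  then have "integrable lebesgue (\<lambda>x. norm (indicator {0<..} x *\<^sub>R
      (complex_of_real x powr (complex_of_real (a + 1) - 1) / of_real (exp x))))"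
    unfolding set_integrable_def by (rule integrable_norm)
  also have "(\<lambda>x. norm (indicator {0<..} x *\<^sub>R
      (complex_of_real x powr (complex_of_real (a + 1) - 1) / of_real (exp x)))) = ?f"
    by (rule ext) (auto simp: indicator_def norm_divide norm_powr_real_powr exp_minus field_simps)
  finally have "integrable lborel ?f"
    by (subst (asm) integrable_completion) auto
  moreover from this have "integrable lborel (\<lambda>x. ?f (- x))"
    using lborel_integrable_real_affine[of ?f "-1" 0] by simp
  ultimately have "integrable lborel (\<lambda>x. ?f x + ?f (- x))"
    by (rule Bochner_Integration.integrable_add)
  also have "(\<lambda>x. ?f x + ?f (- x)) = (\<lambda>x. \<bar>x\<bar> powr a * exp (- \<bar>x\<bar>))"
    by (rule ext) (auto simp: indicator_def)
  finally show ?thesis .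
qed

lemma linear_minus_even_poly_bounded:
  fixes t :: "nat \<Rightarrow> real"
  assumes "m \<ge> 1" "t m > 0" "c \<ge> 0"
  shows "\<exists>C. \<forall>x. c * \<bar>x\<bar> - (\<Sum>k=1..m. t k * x ^ (2 * k)) \<le> C"
proof -
  \<comment> \<open>\<open>B\<close> bounds the lower coefficients. Beyond \<open>X >= 1\<close> all
    lower even powers and |x| are at most |x|^(2m-1), and t_m |x| >= c + B makes the difference
    nonpositive; \<open>C\<close> bounds it on |x| <= X.\<close>
  define B where "B = (\<Sum>k\<in>{1..m} - {m}. \<bar>t k\<bar>)"
  define X where "X = max 1 ((c + B) / t m)"
  define C where "C = c * X + (\<Sum>k=1..m. \<bar>t k\<bar> * X ^ (2 * k))"
  have X: "X \<ge> 1" "t m * X \<ge> c + B"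
    using assms by (auto simp: X_def max_def field_simps)
  have "C \<ge> 0" using X assms by (auto simp: C_def intro!: add_nonneg_nonneg sum_nonneg)
  have "c * \<bar>x\<bar> - (\<Sum>k=1..m. t k * x ^ (2 * k)) \<le> C" for x
  proof (cases "\<bar>x\<bar> \<le> X")
    case True
    have "- (\<Sum>k=1..m. t k * x ^ (2 * k)) \<le> (\<Sum>k=1..m. \<bar>t k\<bar> * X ^ (2 * k))"
      unfolding sum_negf[symmetric]
    proof (rule sum_mono)
      fix k
      have "- (t k * x ^ (2 * k)) \<le> \<bar>t k\<bar> * \<bar>x\<bar> ^ (2 * k)"
        by (metis abs_ge_minus_self abs_mult power_abs)
      also have "\<dots> \<le> \<bar>t k\<bar> * X ^ (2 * k)"
        using True by (intro mult_left_mono power_mono) auto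
      finally show "- (t k * x ^ (2 * k)) \<le> \<bar>t k\<bar> * X ^ (2 * k)" .
    qed
    moreover have "c * \<bar>x\<bar> \<le> c * X" using True assms by (intro mult_left_mono)
    ultimately show ?thesis by (simp add: C_def)
  next
    case False
    let ?y = "\<bar>x\<bar>"
    have y: "?y \<ge> 1" "c + B \<le> t m * ?y"
      using False X order_trans[OF X(2) mult_left_mono[of X ?y "t m"]] assms by auto
    have "- (\<Sum>k\<in>{1..m} - {m}. t k * x ^ (2 * k)) \<le> B * ?y ^ (2 * m - 1)"
      unfolding B_def sum_distrib_right sum_negf[symmetric]
    proof (rule sum_mono)
      fix k assume "k \<in> {1..m} - {m}"
      have "- (t k * x ^ (2 * k)) \<le> \<bar>t k\<bar> * ?y ^ (2 * k)"
        by (metis abs_ge_minus_self abs_mult power_abs)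
      also have "\<dots> \<le> \<bar>t k\<bar> * ?y ^ (2 * m - 1)"
        using y \<open>k \<in> {1..m} - {m}\<close> by (intro mult_left_mono power_increasing) auto
      finally show "- (t k * x ^ (2 * k)) \<le> \<bar>t k\<bar> * ?y ^ (2 * m - 1)" .
    qed
    moreover have "c * ?y \<le> c * ?y ^ (2 * m - 1)"
      using y assms by (intro mult_left_mono self_le_power) auto
    moreover have "(c + B) * ?y ^ (2 * m - 1) \<le> (t m * ?y) * ?y ^ (2 * m - 1)"
      using y by (intro mult_right_mono) auto
    moreover have "(t m * ?y) * ?y ^ (2 * m - 1) = t m * x ^ (2 * m)"
      using assms by (simp add: mult.assoc power_even_abs flip: power_Suc)
    moreover have "(\<Sum>k=1..m. t k * x ^ (2 * k)) = t m * x ^ (2 * m) + (\<Sum>k\<in>{1..m} - {m}. t k * x ^ (2 * k))"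
      using assms by (intro sum.remove) auto
    ultimately show ?thesis using \<open>C \<ge> 0\<close> unfolding distrib_right by linarith
  qed
  then show ?thesis by blast
qed

section \<open>The weight and its integration functional\<close>

lemma weight_measurable [measurable]: "weight m t lam \<in> borel_measurable borel"
  unfolding weight_def[abs_def] by measurable

lemma weight_nonneg: "weight m t lam x \<ge> 0"
  by (simp add: weight_def)

lemma weight_pos: "x \<noteq> 0 \<Longrightarrow> weight m t lam x > 0"
  by (simp add: weight_def)

lemma weight_minus: "weight m t lam (- x) = weight m t lam x"
  by (simp add: weight_def)

lemma weight_fun_upd:
  assumes "k \<in> {1..m}"
  shows "weight m (t(k := s)) lam x = weight m t lam x * exp (- ((s - t k) * x ^ (2 * k)))"
proof -
  have "(\<Sum>i=1..m. u i * x ^ (2 * i)) = u k * x ^ (2 * k) + (\<Sum>i\<in>{1..m} - {k}. u i * x ^ (2 * i))" for u :: "nat \<Rightarrow> real"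
    using assms by (intro sum.remove) auto
  from this[of "t(k := s)"] this[of t]
  have "(\<Sum>i=1..m. (t(k := s)) i * x ^ (2 * i)) = (\<Sum>i=1..m. t i * x ^ (2 * i)) + (s - t k) * x ^ (2 * k)"
    by (simp add: algebra_simps)
  then show ?thesis by (simp add: weight_def exp_add[symmetric] algebra_simps)
qed

context
  fixes m :: nat and lam :: real
  assumes m: "m \<ge> 1" and lam: "lam > -1"
begin

lemma integrable_power_weight:
  assumes "t m > 0"
  shows "integrable lborel (\<lambda>x. x ^ j * weight m t lam x)"
proof -
  let ?Q = "\<lambda>x. \<Sum>k=1..m. t k * x ^ (2 * k)"
  let ?a = "2 * lam + 1"
  \<comment> \<open>Of the slope \<open>j + 1\<close>, the part j absorbs |x|^j <= exp (j |x|), and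
    the part 1 leaves the factor exp (-|x|) of the integrable majorant.\<close>
  obtain C where C: "\<And>x. (real j + 1) * \<bar>x\<bar> - ?Q x \<le> C"
    using linear_minus_even_poly_bounded[where t = t and c = "real j + 1", OF m assms] by auto
  have bound: "\<bar>x ^ j * weight m t lam x\<bar> \<le> exp C * (\<bar>x\<bar> powr ?a * exp (- \<bar>x\<bar>))" for x
  proof -
    have "\<bar>x\<bar> \<le> exp \<bar>x\<bar>"
      using exp_ge_add_one_self[of "\<bar>x\<bar>"] by linarith
    then have "\<bar>x\<bar> ^ j \<le> exp \<bar>x\<bar> ^ j"
      by (intro power_mono) auto
    also have "\<dots> = exp (real j * \<bar>x\<bar>)" by (simp add: exp_of_nat_mult)
    finally have "\<bar>x\<bar> ^ j * exp (- ?Q x) \<le> exp (real j * \<bar>x\<bar>) * exp (- ?Q x)"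
      by (intro mult_right_mono) auto
    also have "\<dots> = exp ((real j + 1) * \<bar>x\<bar> - ?Q x) * exp (- \<bar>x\<bar>)"
      by (simp add: exp_add[symmetric] algebra_simps)
    also have "\<dots> \<le> exp C * exp (- \<bar>x\<bar>)"
      using C by (intro mult_right_mono) auto
    finally have "\<bar>x\<bar> powr ?a * (\<bar>x\<bar> ^ j * exp (- ?Q x)) \<le> \<bar>x\<bar> powr ?a * (exp C * exp (- \<bar>x\<bar>))"
      by (intro mult_left_mono) auto
    then show ?thesis by (simp add: weight_def abs_mult power_abs mult_ac)
  qed
  have dom: "integrable lborel (\<lambda>x. exp C * (\<bar>x\<bar> powr ?a * exp (- \<bar>x\<bar>)))"
    using lam by (intro integrable_mult_right integrable_abs_powr_exp) auto
  show ?thesis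
  proof (rule Bochner_Integration.integrable_bound[OF dom])
    show "AE x in lborel. norm (x ^ j * weight m t lam x) \<le> norm (exp C * (\<bar>x\<bar> powr ?a * exp (- \<bar>x\<bar>)))"
    proof (rule AE_I2)
      fix x
      show "norm (x ^ j * weight m t lam x) \<le> norm (exp C * (\<bar>x\<bar> powr ?a * exp (- \<bar>x\<bar>)))"
        unfolding real_norm_def by (rule order_trans[OF bound abs_ge_self])
    qed
  qed measurable
qed

lemma integrable_poly_weight:
  assumes "t m > 0"
  shows "integrable lborel (\<lambda>x. poly p x * weight m t lam x)"
  unfolding poly_altdef sum_distrib_right mult.assoc
  by (intro Bochner_Integration.integrable_sum integrable_mult_right integrable_power_weight assms)

definition weight_functional :: "(nat \<Rightarrow> real) \<Rightarrow> real poly \<Rightarrow> real" where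
  "weight_functional t p = (\<integral>x. poly p x * weight m t lam x \<partial>lborel)"

lemma weight_functional_pos:
  assumes "t m > 0" "p \<noteq> 0"
  shows "weight_functional t (p * p) > 0"
proof -
  let ?f = "\<lambda>x. poly (p * p) x * weight m t lam x"
  have nonneg: "?f x \<ge> 0" for x by (simp add: weight_nonneg)
  have "weight_functional t (p * p) \<noteq> 0"
  proof
    assume "weight_functional t (p * p) = 0"
    then have "AE x in lborel. ?f x = 0"
      unfolding weight_functional_def
      using integral_nonneg_eq_0_iff_AE[OF integrable_poly_weight[where t = t and p = "p * p", OF assms(1)]] nonneg by simp
    \<comment> \<open>Outside the roots of \<open>p\<close> and the point 0, where
      \<open>weight\<close> is 0, the integrand is positive; the exceptional set is finite, hence
      null.\<close>
    moreover have "AE x in lborel. x \<notin> insert 0 {x. poly p x = 0}"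
      using poly_roots_finite[OF assms(2)]
      by (intro AE_not_in finite_imp_null_set_lborel) auto
    ultimately have "AE x in (lborel :: real measure). False"
      by eventually_elim (auto dest: weight_pos[of _ m t lam])
    then show False
      by (simp add: AE_iff_null emeasure_lborel_UNIV null_sets_def)
  qed
  moreover have "weight_functional t (p * p) \<ge> 0"
    unfolding weight_functional_def using nonneg by (intro Bochner_Integration.integral_nonneg)
  ultimately show ?thesis by simp
qed

lemma even_positive_functional_weight:
  assumes "t m > 0"
  shows "even_positive_functional (weight_functional t)"
proof
  note [simp] = integrable_poly_weight[where t = t, OF assms]
  fix p q :: "real poly" and c :: real
  show "weight_functional t (p + q) = weight_functional t p + weight_functional t q"
    by (simp add: weight_functional_def distrib_right)
  show "weight_functional t (smult c p) = c * weight_functional t p"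
    by (simp add: weight_functional_def mult.assoc)
  show "weight_functional t (p * p) > 0" if "p \<noteq> 0"
    using weight_functional_pos[of t p] assms that by blast
  show "weight_functional t (p \<circ>\<^sub>p [:0, -1:]) = weight_functional t p"
    using lborel_integral_real_affine[of "-1" "\<lambda>x. poly p x * weight m t lam x" 0]
    by (simp add: weight_functional_def poly_pcompose weight_minus)
qed

text \<open>Uniqueness of the monic orthogonal sequence evaluates the first definite description;
  the leading coefficient 1 of \<open>P_(n-1)\<close> determines \<open>b\<close> in the
  second.\<close>

lemma rec_beta_eq:
  assumes "t m > 0"
  shows "rec_beta m t lam (int n) = symm_beta (weight_functional t) n"
proof -
  let ?w = "weight m t lam" and ?J = "weight_functional t"
  interpret even_positive_functional ?J
    by (rule even_positive_functional_weight[where t = t, OF assms])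
  have J: "(\<integral>x. poly p x * poly q x * ?w x \<partial>lborel) = ?J (p * q)" for p q
    by (simp add: weight_functional_def)
  have int: "integrable lborel (\<lambda>x. poly p x * poly q x * ?w x)" for p q
    using integrable_poly_weight[of t "p * q"] assms by simp
  have "(THE P. monic_orthogonal_seq ?w P) = symm_poly ?J"
  proof (rule the_equality)
    show "monic_orthogonal_seq ?w (symm_poly ?J)"
      by (simp add: monic_orthogonal_seq_def J int symm_poly_orthogonal)
    fix P assume "monic_orthogonal_seq ?w P"
    then have P: "degree (P n) = n" "coeff (P n) n = 1" "i \<noteq> j \<Longrightarrow> ?J (P i * P j) = 0" for n i j
      unfolding monic_orthogonal_seq_def J by metis+
    show "P = symm_poly ?J"
      by (rule ext, rule monic_orthogonal_unique) (use P in auto)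
  qed
  then have P: "orth_poly ?w (int n) = symm_poly ?J n" for n
    by (simp add: orth_poly_def)
  show ?thesis
  proof (cases n)
    case (Suc l)
    have idx: "int n + 1 = int (Suc n)" "int n - 1 = int l" using Suc by auto
    have "(THE b. [:0, 1:] * symm_poly ?J n = symm_poly ?J (Suc n) + smult b (symm_poly ?J l)) = symm_beta ?J n"
    proof (rule the_equality)
      show *: "[:0, 1:] * symm_poly ?J n = symm_poly ?J (Suc n) + smult (symm_beta ?J n) (symm_poly ?J l)"
        using x_times_symm_poly[of ?J n] Suc by simp
      fix b assume "[:0, 1:] * symm_poly ?J n = symm_poly ?J (Suc n) + smult b (symm_poly ?J l)"
      then have "smult b (symm_poly ?J l) = smult (symm_beta ?J n) (symm_poly ?J l)"
        using * by (metis add_left_cancel)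
      then have "coeff (smult b (symm_poly ?J l)) l = coeff (smult (symm_beta ?J n) (symm_poly ?J l)) l"
        by simp
      then show "b = symm_beta ?J n" by simp
    qed
    then show ?thesis using Suc
      unfolding rec_beta_def rec_coeff_def idx P by simp
  qed (simp add: rec_beta_def rec_coeff_def)
qed

end

section \<open>Differentiation under the integral sign\<close>

lemma exp_minus_linear_bound:
  fixes y :: real
  shows "\<bar>exp (- y) - 1 + y\<bar> \<le> y\<^sup>2 * exp \<bar>y\<bar>"
proof -
  obtain u where u: "\<bar>u\<bar> \<le> \<bar>- y\<bar>"
    "exp (- y) = (\<Sum>i<2. (- y) ^ i / fact i) + exp u / fact 2 * (- y) ^ 2"
    using Maclaurin_exp_le[of "- y" 2] by blast
  then have "\<bar>exp (- y) - 1 + y\<bar> = y\<^sup>2 * (exp u / 2)"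
    by (simp add: numeral_2_eq_2 abs_mult)
  also have "exp u \<le> exp \<bar>y\<bar>" using u(1) by simp
  then have "exp u / 2 \<le> exp \<bar>y\<bar>" using exp_gt_zero[of "\<bar>y\<bar>"] by linarith
  then have "y\<^sup>2 * (exp u / 2) \<le> y\<^sup>2 * exp \<bar>y\<bar>" by (intro mult_left_mono) auto
  finally show ?thesis .
qed

text \<open>Reduces a derivative to a remainder estimate near \<open>s0\<close>, which for integrals
  follows by integrating a pointwise bound.\<close>

lemma has_real_derivative_quadratic_bound:
  fixes f :: "real \<Rightarrow> real"
  assumes "\<delta> > 0" and "\<And>s. \<bar>s - s0\<bar> \<le> \<delta> \<Longrightarrow> \<bar>f s - f s0 - D * (s - s0)\<bar> \<le> C * (s - s0)\<^sup>2"
  shows "(f has_real_derivative D) (at s0)"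
proof -
  have "((\<lambda>s. (f s - f s0) / (s - s0) - D) \<longlongrightarrow> 0) (at s0)"
  proof (rule Lim_null_comparison)
    have "eventually (\<lambda>s. s \<in> ball s0 \<delta> \<and> s \<noteq> s0) (at s0)"
      using assms(1) by (intro eventually_conj eventually_at_in_open' eventually_neq_at_within) auto
    then show "\<forall>\<^sub>F s in at s0. norm ((f s - f s0) / (s - s0) - D) \<le> C * \<bar>s - s0\<bar>"
    proof eventually_elim
      case (elim s)
      then have "\<bar>f s - f s0 - D * (s - s0)\<bar> \<le> C * \<bar>s - s0\<bar> * \<bar>s - s0\<bar>"
        using assms(2)[of s] by (simp add: dist_real_def abs_minus_commute[of s0] power2_eq_square mult.assoc)
      moreover have "(f s - f s0) / (s - s0) - D = (f s - f s0 - D * (s - s0)) / (s - s0)"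
        using elim by (simp add: field_simps)
      ultimately show ?case
        using elim by (simp add: abs_divide pos_divide_le_eq)
    qed
    have "((\<lambda>s. C * \<bar>s - s0\<bar>) \<longlongrightarrow> C * \<bar>s0 - s0\<bar>) (at s0)"
      by (intro tendsto_intros)
    then show "((\<lambda>s. C * \<bar>s - s0\<bar>) \<longlongrightarrow> 0) (at s0)" by simp
  qed
  then show ?thesis by (simp add: has_field_derivative_iff LIM_zero_iff)
qed

lemma deriv_weight_functional:
  assumes m: "m \<ge> 1" and lam: "lam > -1" and k: "k \<in> {1..m}" and t: "t m > 0"
  shows "((\<lambda>s. weight_functional m lam (t(k := s)) p) has_real_derivative
     - weight_functional m lam t (monom 1 (2 * k) * p)) (at (t k))"
proof -
  \<comment> \<open>Half of t_m keeps the m-th parameter positive on the whole closed interval, even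
    for k = m.\<close>
  define \<delta> where "\<delta> = t m / 2"
  have "\<delta> > 0" using t by (simp add: \<delta>_def)
  have pos: "(t(k := s)) m > 0" if "\<bar>s - t k\<bar> \<le> \<delta>" for s
  proof -
    have "t k - \<delta> \<le> s" using that by (simp add: abs_le_iff)
    then show ?thesis using t by (auto simp: \<delta>_def)
  qed
  let ?w = "\<lambda>s. weight m (t(k := s)) lam"
  \<comment> \<open>Majorant of the Taylor remainder: \<open>4 * k\<close> comes from the square of
    h x^(2k), and lowering t_k by \<delta> absorbs exp (\<delta> x^(2k)).\<close>
  let ?g = "\<lambda>x. norm (poly (monom 1 (4 * k) * p) x * ?w (t k - \<delta>) x)"
  have int: "integrable lborel (\<lambda>x. poly q x * ?w s x)" if "\<bar>s - t k\<bar> \<le> \<delta>" for s q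
    using integrable_poly_weight[OF m lam, of "t(k := s)"] pos[OF that] by blast
  have int0: "integrable lborel (\<lambda>x. poly q x * weight m t lam x)" for q
    using integrable_poly_weight[OF m lam, of t] t by blast
  have intg: "integrable lborel ?g"
    using \<open>\<delta> > 0\<close> by (intro integrable_norm int) auto
  show ?thesis
  proof (rule has_real_derivative_quadratic_bound[OF \<open>\<delta> > 0\<close>, where C = "\<integral>x. ?g x \<partial>lborel"])
    fix s assume s: "\<bar>s - t k\<bar> \<le> \<delta>"
    let ?h = "s - t k"
    let ?r = "\<lambda>x. poly p x * ?w s x - poly p x * weight m t lam x
      + ?h * (poly (monom 1 (2 * k) * p) x * weight m t lam x)"
    have eq: "weight_functional m lam (t(k := s)) p - weight_functional m lam (t(k := t k)) p
        - - weight_functional m lam t (monom 1 (2 * k) * p) * ?h = (\<integral>x. ?r x \<partial>lborel)"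
      using int[OF s] int0
      by (simp add: weight_functional_def[OF m lam] del: poly_mult)
    have "norm (\<integral>x. ?r x \<partial>lborel) \<le> (\<integral>x. ?h\<^sup>2 * ?g x \<partial>lborel)"
    proof (rule Bochner_Integration.integral_norm_bound_integral)
      show "integrable lborel ?r"
        using int[OF s] int0 by (intro Bochner_Integration.integrable_add Bochner_Integration.integrable_diff integrable_mult_right)
      show "integrable lborel (\<lambda>x. ?h\<^sup>2 * ?g x)"
        using intg by (intro integrable_mult_right)
      fix x :: real
      define u where "u = x ^ (2 * k)"
      have "u \<ge> 0" by (simp add: u_def)
      have abs4: "\<bar>x ^ (k * 4)\<bar> = x ^ (k * 4)" by (simp add: zero_le_even_power)
      have "?r x = poly p x * weight m t lam x * (exp (- (?h * u)) - 1 + ?h * u)"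
        by (simp add: weight_fun_upd[OF k] u_def poly_monom algebra_simps)
      also have "norm \<dots> \<le> \<bar>poly p x\<bar> * weight m t lam x * ((?h * u)\<^sup>2 * exp \<bar>?h * u\<bar>)"
        unfolding real_norm_def abs_mult abs_of_nonneg[OF weight_nonneg]
        by (intro mult_left_mono exp_minus_linear_bound[of "?h * u", unfolded abs_mult] mult_nonneg_nonneg weight_nonneg) auto
      also have "\<dots> \<le> \<bar>poly p x\<bar> * weight m t lam x * ((?h * u)\<^sup>2 * exp (\<delta> * u))"
        using s \<open>u \<ge> 0\<close> by (intro mult_left_mono mult_nonneg_nonneg weight_nonneg)
          (auto simp: abs_mult intro: mult_right_mono)
      also have "\<dots> = ?h\<^sup>2 * ?g x"
        by (simp add: weight_fun_upd[OF k] u_def poly_monom abs_mult weight_nonneg power_mult_distrib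
            power_mult[symmetric] mult_ac abs4)
      finally show "norm (?r x) \<le> ?h\<^sup>2 * ?g x" .
    qed
    then show "\<bar>weight_functional m lam (t(k := s)) p - weight_functional m lam (t(k := t k)) p
        - - weight_functional m lam t (monom 1 (2 * k) * p) * ?h\<bar> \<le> (\<integral>x. ?g x \<partial>lborel) * ?h\<^sup>2"
      unfolding eq real_norm_def Bochner_Integration.integral_mult_right_zero
      by (simp only: mult.commute[of "?h\<^sup>2"])
  qed
qed

theorem theorem4:
  fixes m k :: nat and t :: "nat \<Rightarrow> real" and lam :: real and n :: int
  assumes "m \<ge> 1"
    and "t m > 0"
    and "lam > -1"
    and "1 \<le> k" and "k \<le> m"
    and "n \<ge> 1"
  shows "((\<lambda>s. rec_beta m (t(k := s)) lam n) has_real_derivative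
           rec_F (rec_beta m t lam) 1 n * (rec_F (rec_beta m t lam) k (n - 1) - rec_F (rec_beta m t lam) k (n + 1))) (at (t k))"
proof -
  define J where "J = (\<lambda>s. weight_functional m lam (t(k := s)))"
  \<comment> \<open>Only t_m has to stay positive; every other parameter may range over all
    reals.\<close>
  define S where "S = (if k = m then {0<..} else UNIV :: real set)"
  have S: "s \<in> S \<Longrightarrow> (t(k := s)) m > 0" for s
    using assms(2) by (auto simp: S_def split: if_splits)
  have "t k \<in> S" using assms(2) by (auto simp: S_def)
  interpret even_positive_family J S "t k" k
  proof (rule even_positive_family.intro)
    show "open S" by (auto simp: S_def)
    show "t k \<in> S" by fact
    show "even_positive_functional (J s)" if "s \<in> S" for s
      unfolding J_def using even_positive_functional_weight assms S[OF that] by blast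
    show "((\<lambda>s. J s p) has_real_derivative - J (t k) (monom 1 (2 * k) * p)) (at (t k))" for p
      unfolding J_def using deriv_weight_functional[of m lam k t p] assms by simp
  qed
  obtain l where l: "n = int l" "l \<ge> 1"
    using assms(6) by (metis nonneg_int_cases of_nat_1 of_nat_le_iff order_trans zero_le_one)
  have beta: "rec_beta m (t(k := s)) lam (int i) = symm_beta (J s) i" if "s \<in> S" for s i
    unfolding J_def using rec_beta_eq[OF assms(1,3), of "t(k := s)"] S[OF that] by simp
  have beta0: "rec_beta m t lam (int i) = symm_beta (J (t k)) i" for i
    using beta[OF \<open>t k \<in> S\<close>] by simp
  \<comment> \<open>Since n >= 1, the index n - 1 is natural; it may be 0, so the identification of
    \<open>rec_F\<close> is used at index 0 too.\<close>
  have idx: "n - 1 = int (l - 1)" "n + 1 = int (l + 1)" using l by auto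
  have "((\<lambda>s. symm_beta (J s) l) has_real_derivative
           rec_F (rec_beta m t lam) 1 n * (rec_F (rec_beta m t lam) k (n - 1) - rec_F (rec_beta m t lam) k (n + 1))) (at (t k))"
    unfolding idx unfolding l
    using deriv_symm_beta_subdiag[of l] assms(4) l
    by (simp only: rec_F_eq_subdiag[of "rec_beta m t lam", OF beta0] subdiag_1 order_refl)
  \<comment> \<open>\<open>rec_beta\<close> is identified with \<open>symm_beta\<close> on
    \<open>S\<close> only, which is open and contains \<open>t k\<close>.\<close>
  then show ?thesis
    unfolding l
    by (rule has_field_derivative_transform_within_open[OF _ open_S \<open>t k \<in> S\<close>]) (simp add: beta)
qed

end
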